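(* Let $\{a_m\}_{m\ge0}$ be a convergent real sequence and let $u\in C(\overline\Omega)$ solve the boundary value problem $\Delta u=0$ on $\Omega$, $u(q_1)=a_0$, $u(x_m)=a_m$ $(m\ge1)$. Then the normal derivative $\uparrow\!\partial_nu(q_0)$ exists if and only if the boundary data has the representation $$a_m=A_1+A_2\Big(\frac35\Big)^m+o\Big(\Big(\frac35\Big)^m\Big)\qquad(m\to\infty)$$ for some constants $A_1$ and $A_2$.
   Context: Let $q_0,q_1,q_2$ be the vertices of an equilateral triangle, $F_j(x)=(x+q_j)/2$, and let $SG$ be the Sierpinski gasket, the nonempty compact set with $SG=\bigcup_{j=0}^2F_jSG$. A cell of level $m$ is $F_{w_1}\cdots F_{w_m}SG$; its boundary points are $F_{w_1}\cdots F_{w_m}q_j$, $j=0,1,2$. Half gasket: $x_m=F_0^{m-1}F_2q_1$ ($m\ge1$), $y_m=F_0^mq_1$ ($m\ge0$, so $y_0=q_1$), $\overline Y_m=F_0^{m-1}F_1SG$ ($m\ge 1$), a level-$m$ cell with boundary points $y_{m-1},y_m,x_m$. Put $X=\{x_m\}_{m\ge1}$, $\overline\Omega=\{q_0\}\cup\bigcup_{m\ge1}\overline Y_m$, $\partial\Omega=\{q_0,q_1\}\cup X$, $\Omega=\overline\Omega\setminus\partial\Omega$. A function on a cell is harmonic if it is the continuous function determined by its values at the three boundary points $v_0,v_1,v_2$ through the harmonic extension algorithm: at the level-one-finer junction point between $v_i$ and $v_j$ it takes the value $(2u(v_i)+2u(v_j)+u(v_k))/5$, and this is iterated on all smaller cells.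 $\Delta$ is the Kigami Laplacian for the standard measure. "$\Delta u=0$ on $\Omega$" means: $u$ is harmonic on each $\overline Y_m$, and at each $y_m$, $m\ge1$, $$\Big(\tfrac53\Big)^m[2u(y_m)-u(y_{m-1})-u(x_m)]+\Big(\tfrac53\Big)^{m+1}[2u(y_m)-u(y_{m+1})-u(x_{m+1})]=0 .$$ For such $u$ the normal derivative at $y_m$ with respect to the cell $\overline Y_m$ is $\nearrow\!\partial_nu(y_m)=(5/3)^m[2u(y_m)-u(y_{m-1})-u(x_m)]$, and the normal derivative at $q_0$ of a function on $\overline\Omega$ is defined by $$\uparrow\!\partial_nu(q_0)=2\lim_{m\to\infty}\nearrow\!\partial_nu(y_m),$$ and is said to exist when this (finite) limit exists. *)

theory Defs
  imports "HOL-Analysis.Analysis" "HOL-Library.Landau_Symbols"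
begin

text \<open>Only the values of \<open>q\<close> at 0, 1, 2 are used.\<close>

definition equilateral :: "(nat \<Rightarrow> real^2) \<Rightarrow> bool" where
  "equilateral q \<longleftrightarrow>
     q 0 \<noteq> q 1 \<and> dist (q 0) (q 1) = dist (q 1) (q 2) \<and> dist (q 1) (q 2) = dist (q 2) (q 0)"

definition F :: "(nat \<Rightarrow> real^2) \<Rightarrow> nat \<Rightarrow> real^2 \<Rightarrow> real^2" where
  "F q j x = (1/2) *\<^sub>R (x + q j)"

text \<open>The Sierpinski gasket is the unique set with the following property.\<close>

definition is_gasket :: "(nat \<Rightarrow> real^2) \<Rightarrow> (real^2) set \<Rightarrow> bool" where
  "is_gasket q K \<longleftrightarrow> K \<noteq> {} \<and> compact K \<and> K = (\<Union>j<3. F q j ` K)"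

text \<open>\<open>Fw q [w\<^sub>1, \<dots>, w\<^sub>m]\<close> is the composition \<open>F q w\<^sub>1 \<circ> \<dots> \<circ> F q w\<^sub>m\<close>.\<close>

definition Fw :: "(nat \<Rightarrow> real^2) \<Rightarrow> nat list \<Rightarrow> real^2 \<Rightarrow> real^2" where
  "Fw q w x = foldr (F q) w x"

text \<open>The cell \<open>Fw q w ` K\<close> has the subcells \<open>Fw q (w @ v) ` K\<close>. In the subcell of a word \<open>v\<close>, the
  point \<open>Fw q (w @ v @ [i]) (q j)\<close> is the junction point halfway between the boundary points
  \<open>Fw q (w @ v) (q i)\<close> and \<open>Fw q (w @ v) (q j)\<close>.\<close>

definition harmonic_on_cell ::
  "(nat \<Rightarrow> real^2) \<Rightarrow> (real^2) set \<Rightarrow> nat list \<Rightarrow> (real^2 \<Rightarrow> real) \<Rightarrow> bool" where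
  "harmonic_on_cell q K w u \<longleftrightarrow>
     continuous_on (Fw q w ` K) u \<and>
     (\<forall>v i j k. set v \<subseteq> {0,1,2} \<longrightarrow> {i, j, k} = {0,1,2} \<longrightarrow>
        u (Fw q (w @ v @ [i]) (q j)) =
          (2 * u (Fw q (w @ v) (q i)) + 2 * u (Fw q (w @ v) (q j)) + u (Fw q (w @ v) (q k))) / 5)"

text \<open>The points \<open>xpt q m\<close> and the cells of the words \<open>Yword m\<close> are meant for \<open>m \<ge> 1\<close>.\<close>

definition xpt :: "(nat \<Rightarrow> real^2) \<Rightarrow> nat \<Rightarrow> real^2" where
  "xpt q m = Fw q (replicate (m - 1) 0 @ [2]) (q 1)"

definition ypt :: "(nat \<Rightarrow> real^2) \<Rightarrow> nat \<Rightarrow> real^2" where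
  "ypt q m = Fw q (replicate m 0) (q 1)"

definition Yword :: "nat \<Rightarrow> nat list" where
  "Yword m = replicate (m - 1) 0 @ [1]"

definition Omega_bar :: "(nat \<Rightarrow> real^2) \<Rightarrow> (real^2) set \<Rightarrow> (real^2) set" where
  "Omega_bar q K = {q 0} \<union> (\<Union>m\<in>{1..}. Fw q (Yword m) ` K)"

text \<open>Normal derivative at \<open>ypt q m\<close>, \<open>m \<ge> 1\<close>, with respect to the cell of \<open>Yword m\<close>.\<close>

definition normal_deriv_y :: "(nat \<Rightarrow> real^2) \<Rightarrow> (real^2 \<Rightarrow> real) \<Rightarrow> nat \<Rightarrow> real" where
  "normal_deriv_y q u m = (5/3)^m * (2 * u (ypt q m) - u (ypt q (m - 1)) - u (xpt q m))"

text \<open>\<open>\<Delta>u = 0\<close> on the half gasket: harmonicity on every cell, and the normal derivatives at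
  \<open>ypt q m\<close> with respect to the two adjacent cells add up to 0.\<close>

definition laplace_zero ::
  "(nat \<Rightarrow> real^2) \<Rightarrow> (real^2) set \<Rightarrow> (real^2 \<Rightarrow> real) \<Rightarrow> bool" where
  "laplace_zero q K u \<longleftrightarrow>
     (\<forall>m\<ge>1. harmonic_on_cell q K (Yword m) u) \<and>
     (\<forall>m\<ge>1. (5/3)^m * (2 * u (ypt q m) - u (ypt q (m - 1)) - u (xpt q m)) +
            (5/3)^(m + 1) * (2 * u (ypt q m) - u (ypt q (m + 1)) - u (xpt q (m + 1))) = 0)"

definition has_normal_deriv_q0 ::
  "(nat \<Rightarrow> real^2) \<Rightarrow> (real^2 \<Rightarrow> real) \<Rightarrow> real \<Rightarrow> bool" where
  "has_normal_deriv_q0 q u D \<longleftrightarrow> (\<exists>L. normal_deriv_y q u \<longlonglongrightarrow> L \<and> D = 2 * L)"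

end

theory Submission
  imports Defs
begin

text \<open>
  Write \<open>b m\<close> for the value of the solution at \<open>y\<^sub>m\<close> and \<open>a m\<close> for its value at \<open>x\<^sub>m\<close>. Matching the
  normal derivatives at \<open>y\<^sub>m\<close> gives a linear recurrence for \<open>b\<close> with source \<open>a\<close>,
  whose characteristic roots are \<open>3\<close> and \<open>1/5\<close>. Both lie away from \<open>3/5\<close>, one on each side, so the
  operator is invertible at the scale \<open>(3/5)^m\<close>, provided that the growing mode \<open>3^m\<close> is
  absent. Continuity of the solution at \<open>q\<^sub>0\<close> excludes that mode, because
  \<open>y\<^sub>m\<close> tends to \<open>q\<^sub>0\<close> and \<open>b\<close> therefore converges.

  If \<open>a m = A\<^sub>1 + A\<^sub>2 (3/5)^m + o((3/5)^m)\<close>, subtracting the particular solution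
  \<open>A\<^sub>1 + (3/4) A\<^sub>2 (3/5)^m\<close> from \<open>b\<close> and multiplying by \<open>(5/3)^m\<close> leaves a recurrence with roots
  \<open>5\<close> and \<open>1/3\<close> and a source that tends to 0. The factor of root \<open>5\<close> is solved from infinity
  (\<open>null_sequence_backward\<close>), the factor of root \<open>1/3\<close> from the start (\<open>null_sequence_forward\<close>), and
  so the remainder is \<open>o((3/5)^m)\<close>. Hence the normal derivatives at \<open>y\<^sub>m\<close> converge, to
  \<open>-(3/4) A\<^sub>2\<close>.

  Conversely, the differences \<open>b (m + 1) - b m\<close> are proportional to the sums of two consecutive
  normal derivatives. If these converge to \<open>L\<close>, summing the tail gives
  \<open>b m = B - L (3/5)^m + o((3/5)^m)\<close> with \<open>B\<close> the value at \<open>q\<^sub>0\<close>, and the definition of the normal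
  derivative at \<open>y\<^sub>m\<close> turns this into the expansion of \<open>a\<close> with \<open>A\<^sub>1 = B\<close>, \<open>A\<^sub>2 = -(4/3) L\<close>.
\<close>

section \<open>First-order recurrences with a vanishing source\<close>

text \<open>A contraction forgets its initial value: from index \<open>M\<close> on the source contributes at most a
  geometric series, and the value at \<open>M\<close> is damped by \<open>r^n\<close>.\<close>

lemma null_sequence_forward:
  fixes X h :: "nat \<Rightarrow> real"
  assumes r: "0 \<le> r" "r < 1"
    and rec: "\<And>m. X (Suc m) = r * X m + h m"
    and h: "h \<longlonglongrightarrow> 0"
  shows "X \<longlonglongrightarrow> 0"
proof (rule LIMSEQ_I)
  fix e :: real assume e: "0 < e"
  \<comment> \<open>The factor \<open>1 - r\<close> makes the geometric series of the source sum to at most \<open>e / 2\<close>.\<close>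
  from h e r obtain M where M: "\<And>k. k \<ge> M \<Longrightarrow> \<bar>h k\<bar> < (1 - r) * (e / 2)"
    using LIMSEQ_D[of h 0 "(1 - r) * (e / 2)"] by fastforce
  have bound: "\<bar>X (M + n)\<bar> \<le> r ^ n * \<bar>X M\<bar> + (1 - r ^ n) * (e / 2)" for n
  proof (induction n)
    case (Suc n)
    have "\<bar>X (M + Suc n)\<bar> \<le> r * \<bar>X (M + n)\<bar> + \<bar>h (M + n)\<bar>"
      using rec[of "M + n"] r abs_triangle_ineq[of "r * X (M + n)" "h (M + n)"]
      by (simp add: abs_mult)
    also have "\<dots> \<le> r * (r ^ n * \<bar>X M\<bar> + (1 - r ^ n) * (e / 2)) + (1 - r) * (e / 2)"
      using Suc.IH r M[of "M + n"] by (intro add_mono mult_left_mono) auto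
    finally show ?case by (simp add: field_simps)
  qed simp
  have "(\<lambda>n. r ^ n * \<bar>X M\<bar>) \<longlonglongrightarrow> 0"
    using r by (intro tendsto_mult_left_zero LIMSEQ_realpow_zero) auto
  from LIMSEQ_D[OF this, of "e / 2"] e obtain N where
    N: "\<And>n. n \<ge> N \<Longrightarrow> r ^ n * \<bar>X M\<bar> < e / 2" by fastforce
  have "norm (X k - 0) < e" if k_ge: "k \<ge> M + N" for k
  proof -
    obtain n where k: "k = M + n" and n: "n \<ge> N"
      using k_ge by (intro that[of "k - M"]) auto
    have "(1 - r ^ n) * (e / 2) \<le> e / 2"
      using r e by (simp add: mult_le_cancel_right1)
    then show ?thesis using bound[of n] N[OF n] k by simp
  qed
  then show "\<exists>n0. \<forall>k\<ge>n0. norm (X k - 0) < e" by blast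
qed

text \<open>The same recurrence read towards smaller indices, which is how an expanding
  recurrence \<open>X (m + 1) = (X m - h m) / r\<close> is solved: iterating expresses \<open>X m\<close> by later
  sources only, once the growth condition removes the contribution from infinity, that is the
  homogeneous solution \<open>(1 / r)^m\<close>.\<close>

lemma null_sequence_backward:
  fixes X h :: "nat \<Rightarrow> real"
  assumes r: "0 \<le> r" "r < 1"
    and rec: "\<And>m. X m = r * X (Suc m) + h m"
    and h: "h \<longlonglongrightarrow> 0"
    and growth: "\<And>m. (\<lambda>n. r ^ n * X (m + n)) \<longlonglongrightarrow> 0"
  shows "X \<longlonglongrightarrow> 0"
proof (rule LIMSEQ_I)
  fix e :: real assume e: "0 < e"
  from h e r obtain M where M: "\<And>k. k \<ge> M \<Longrightarrow> \<bar>h k\<bar> < (1 - r) * (e / 2)"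
    using LIMSEQ_D[of h 0 "(1 - r) * (e / 2)"] by fastforce
  have "norm (X m - 0) < e" if m: "m \<ge> M" for m
  proof -
    have bound: "\<bar>X m\<bar> \<le> \<bar>r ^ n * X (m + n)\<bar> + (1 - r ^ n) * (e / 2)" for n
    proof (induction n)
      case (Suc n)
      have "\<bar>X (m + n)\<bar> \<le> r * \<bar>X (m + Suc n)\<bar> + \<bar>h (m + n)\<bar>"
        using rec[of "m + n"] r abs_triangle_ineq[of "r * X (Suc (m + n))" "h (m + n)"]
        by (simp add: abs_mult)
      also have "\<dots> \<le> r * \<bar>X (m + Suc n)\<bar> + (1 - r) * (e / 2)"
        using M[of "m + n"] m by simp
      finally have "r ^ n * \<bar>X (m + n)\<bar> \<le> r ^ n * (r * \<bar>X (m + Suc n)\<bar> + (1 - r) * (e / 2))"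
        using r by (intro mult_left_mono) auto
      with Suc.IH show ?case using r by (simp add: abs_mult field_simps)
    qed simp
    from LIMSEQ_D[OF growth[of m], of "e / 2"] e obtain n where
      n: "\<bar>r ^ n * X (m + n)\<bar> < e / 2" by fastforce
    have "(1 - r ^ n) * (e / 2) \<le> e / 2"
      using r e by (simp add: mult_le_cancel_right1)
    then show ?thesis using bound[of n] n by simp
  qed
  then show "\<exists>n0. \<forall>k\<ge>n0. norm (X k - 0) < e" by blast
qed

section \<open>The matching condition along the boundary sequence\<close>

text \<open>The characteristic polynomial of this recurrence is \<open>5 r\<^sup>2 - 16 r + 3 = (r - 3) (5 r - 1)\<close>.\<close>

definition matching_recurrence :: "(nat \<Rightarrow> real) \<Rightarrow> (nat \<Rightarrow> real) \<Rightarrow> bool" where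
  "matching_recurrence a b \<longleftrightarrow>
     (\<forall>m. 5 * b (m + 2) = 16 * b (m + 1) - 3 * b m - 3 * a (m + 1) - 5 * a (m + 2))"

text \<open>The normal derivatives, renumbered so that they start at index 0.\<close>

definition flux :: "(nat \<Rightarrow> real) \<Rightarrow> (nat \<Rightarrow> real) \<Rightarrow> nat \<Rightarrow> real" where
  "flux a b m = (5/3) ^ Suc m * (2 * b (Suc m) - b m - a (Suc m))"

lemma rescaled_expansion:
  "(5/3) ^ m * (x - (c + d * (3/5) ^ m)) = (5/3) ^ m * (x - c) - (d :: real)"
proof -
  define p r :: real where "p = (5/3) ^ m" and "r = (3/5) ^ m"
  have "p * r = 1" by (simp add: p_def r_def flip: power_mult_distrib)
  moreover have "p * (x - (c + d * r)) = p * (x - c) - d * (p * r)"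
    by (simp add: algebra_simps)
  ultimately show ?thesis by (simp add: p_def r_def)
qed

text \<open>The hypothesis \<open>b \<longlonglongrightarrow> B\<close> serves to exclude the homogeneous solution \<open>3^m\<close>, for which the flux
  diverges; that solution corresponds to \<open>5^m\<close> after rescaling, so the growth condition of
  \<open>null_sequence_backward\<close> fails for it.\<close>

lemma flux_converges_if_expansion:
  assumes rec: "matching_recurrence a b"
    and b: "b \<longlonglongrightarrow> B"
    and a: "(\<lambda>m. (5/3) ^ m * (a m - (A1 + A2 * (3/5) ^ m))) \<longlonglongrightarrow> 0"
  shows "flux a b \<longlonglongrightarrow> - (3/4) * A2"
proof -
  define E where "E m = (5/3) ^ m * (a m - (A1 + A2 * (3/5) ^ m))" for m
  define C where "C m = (5/3) ^ m * (b m - A1) - (3/4) * A2" for m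
  have E: "E \<longlonglongrightarrow> 0" using a by (simp add: E_def[abs_def])
  have a_eq: "(5/3) ^ m * (a m - A1) = E m + A2" for m
    by (simp add: E_def rescaled_expansion)
  have b_eq: "(5/3) ^ m * (b m - A1) = C m + (3/4) * A2" for m
    by (simp add: C_def)
  have C_rec: "C (m + 2) = (16/3) * C (m + 1) - (5/3) * C m - E (m + 1) - E (m + 2)" for m
  proof -
    have "5 * b (m + 2) = 16 * b (m + 1) - 3 * b m - 3 * a (m + 1) - 5 * a (m + 2)"
      using rec by (simp add: matching_recurrence_def)
    then have shifted: "5 * (b (m + 2) - A1) = 16 * (b (m + 1) - A1) - 3 * (b m - A1)
        - 3 * (a (m + 1) - A1) - 5 * (a (m + 2) - A1)" by simp
    define p :: real where "p = (5/3) ^ m"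
    have p: "(5/3) ^ m = p" "(5/3) ^ (m + 1) = (5/3) * p" "(5/3) ^ (m + 2) = (25/9) * p"
      by (simp_all add: p_def)
    have "5 * ((25/9) * p * (b (m + 2) - A1)) = (25/9) * p * (5 * (b (m + 2) - A1))"
      by simp
    also have "\<dots> = (80/3) * ((5/3) * p * (b (m + 1) - A1)) - (25/3) * (p * (b m - A1))
        - 5 * ((5/3) * p * (a (m + 1) - A1)) - 5 * ((25/9) * p * (a (m + 2) - A1))"
      unfolding shifted by (simp add: field_simps)
    finally have "5 * ((5/3) ^ (m + 2) * (b (m + 2) - A1)) =
        (80/3) * ((5/3) ^ (m + 1) * (b (m + 1) - A1)) - (25/3) * ((5/3) ^ m * (b m - A1))
        - 5 * ((5/3) ^ (m + 1) * (a (m + 1) - A1)) - 5 * ((5/3) ^ (m + 2) * (a (m + 2) - A1))"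
      unfolding p .
    then show ?thesis unfolding a_eq b_eq by (simp add: field_simps)
  qed
  \<comment> \<open>Rescaling has moved the roots to \<open>5\<close> and \<open>1/3\<close>; \<open>S\<close> divides out the root \<open>1/3\<close>.\<close>
  define S where "S m = C (Suc m) - (1/3) * C m" for m
  have "S \<longlonglongrightarrow> 0"
  proof (rule null_sequence_backward[where r = "1/5"])
    show "S m = 1/5 * S (Suc m) + 1/5 * (E (m + 1) + E (m + 2))" for m
      using C_rec[of m] by (simp add: S_def field_simps)
    have "(\<lambda>m. 1/5 * (E (m + 1) + E (m + 2))) \<longlonglongrightarrow> 1/5 * (0 + 0)"
      by (intro tendsto_intros LIMSEQ_ignore_initial_segment E)
    then show "(\<lambda>m. 1/5 * (E (m + 1) + E (m + 2))) \<longlonglongrightarrow> 0" by simp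
    fix m
    have C_growth: "(\<lambda>n. (1/5) ^ n * C (k + n)) \<longlonglongrightarrow> 0" for k
    proof -
      have "(\<lambda>n. (5/3) ^ k * ((1/3) ^ n * (b (n + k) - A1)) - (1/5) ^ n * ((3/4) * A2))
          \<longlonglongrightarrow> (5/3) ^ k * (0 * (B - A1)) - 0 * ((3/4) * A2)"
        by (intro tendsto_intros LIMSEQ_ignore_initial_segment b LIMSEQ_realpow_zero) auto
      moreover have "(5/3) ^ k * ((1/3) ^ n * (b (n + k) - A1)) - (1/5) ^ n * ((3/4) * A2)
          = (1/5) ^ n * C (k + n)" for n
      proof -
        have "(1/3::real) ^ n = (1/5) ^ n * (5/3) ^ n"
          by (simp flip: power_mult_distrib)
        then show ?thesis by (simp add: C_def power_add algebra_simps)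
      qed
      ultimately show ?thesis by simp
    qed
    have "(\<lambda>n. (1/5) ^ n * C (Suc m + n) - (1/3) * ((1/5) ^ n * C (m + n))) \<longlonglongrightarrow> 0 - (1/3) * 0"
      by (intro tendsto_intros C_growth)
    then show "(\<lambda>n. (1/5) ^ n * S (m + n)) \<longlonglongrightarrow> 0"
      by (simp add: S_def algebra_simps)
  qed auto
  then have C: "C \<longlonglongrightarrow> 0"
    by (intro null_sequence_forward[where r = "1/3" and X = C and h = S]) (auto simp: S_def)
  have flux_eq: "flux a b = (\<lambda>m. 2 * (C (Suc m) + (3/4) * A2) - (5/3) * (C m + (3/4) * A2)
      - (E (Suc m) + A2))"
    unfolding a_eq[symmetric] b_eq[symmetric] flux_def[abs_def]
    by (rule ext) (simp add: field_simps)
  have "flux a b \<longlonglongrightarrow> 2 * (0 + (3/4) * A2) - (5/3) * (0 + (3/4) * A2) - (0 + A2)"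
    unfolding flux_eq by (intro tendsto_intros C E LIMSEQ_Suc)
  then show ?thesis by simp
qed

text \<open>A convergent flux makes the increments of \<open>b\<close> geometric of ratio \<open>3/5\<close> to leading order;
  knowing the limit \<open>B\<close> allows them to be summed from infinity.\<close>

lemma expansion_if_flux_converges:
  assumes rec: "matching_recurrence a b"
    and b: "b \<longlonglongrightarrow> B"
    and flux: "flux a b \<longlonglongrightarrow> L"
  shows "(\<lambda>m. (5/3) ^ m * (a m - (B + (- (4/3) * L) * (3/5) ^ m))) \<longlonglongrightarrow> 0"
proof -
  \<comment> \<open>By matching, both fluxes on the right are, up to sign, normal derivatives with respect to one
    cell, at its boundary points with values \<open>b (m + 1)\<close> and \<open>b (m + 2)\<close>. Adding them
    cancels the third boundary value \<open>a (m + 2)\<close>.\<close>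
  have increment: "3 * ((5/3) ^ (m + 2) * (b (m + 2) - b (m + 1)))
      = flux a b (Suc m) + flux a b m" for m
  proof -
    have "5 * b (m + 2) = 16 * b (m + 1) - 3 * b m - 3 * a (m + 1) - 5 * a (m + 2)"
      using rec by (simp add: matching_recurrence_def)
    then have incr: "3 * (b (m + 2) - b (m + 1)) = (2 * b (m + 2) - b (m + 1) - a (m + 2))
        + (3/5) * (2 * b (m + 1) - b m - a (m + 1))" by (simp add: field_simps)
    define p :: real where "p = (5/3) ^ (m + 1)"
    have p: "(5/3) ^ (m + 1) = p" "(5/3) ^ (m + 2) = (5/3) * p"
      by (simp_all add: p_def)
    have "3 * ((5/3) * p * (b (m + 2) - b (m + 1)))
        = (5/3) * p * (3 * (b (m + 2) - b (m + 1)))" by simp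
    also have "\<dots> = (5/3) * p * (2 * b (m + 2) - b (m + 1) - a (m + 2))
        + p * (2 * b (m + 1) - b m - a (m + 1))"
      unfolding incr by (simp add: distrib_left)
    finally show ?thesis using p by (simp add: flux_def)
  qed
  define X where "X m = (5/3) ^ m * (B - b m) - L" for m
  have "(\<lambda>m. X (Suc m)) \<longlonglongrightarrow> 0"
  proof (rule null_sequence_backward[where r = "3/5"])
    show "X (Suc m) = 3/5 * X (Suc (Suc m))
        + (1/5 * (flux a b (Suc m) + flux a b m) - 2/5 * L)" for m
      using increment[of m] by (simp add: X_def field_simps)
    have "(\<lambda>m. 1/5 * (flux a b (Suc m) + flux a b m) - 2/5 * L) \<longlonglongrightarrow> 1/5 * (L + L) - 2/5 * L"
      by (intro tendsto_intros flux LIMSEQ_Suc)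
    then show "(\<lambda>m. 1/5 * (flux a b (Suc m) + flux a b m) - 2/5 * L) \<longlonglongrightarrow> 0" by simp
    fix m
    have "(\<lambda>n. (5/3) ^ Suc m * (B - b (n + Suc m)) - (3/5) ^ n * L)
        \<longlonglongrightarrow> (5/3) ^ Suc m * (B - B) - 0 * L"
      by (intro tendsto_intros LIMSEQ_ignore_initial_segment b LIMSEQ_realpow_zero) auto
    moreover have "(5/3) ^ Suc m * (B - b (n + Suc m)) - (3/5) ^ n * L
        = (3/5) ^ n * X (Suc (m + n))" for n
    proof -
      have "(3/5::real) ^ n * (5/3) ^ n = 1" by (simp flip: power_mult_distrib)
      then have "(3/5::real) ^ n * (5/3) ^ Suc (m + n) = (5/3) ^ Suc m"
        by (simp add: power_add)
      then have "(3/5) ^ n * ((5/3) ^ Suc (m + n) * (B - b (Suc (m + n))))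
          = (5/3) ^ Suc m * (B - b (Suc (m + n)))" by (metis mult.assoc)
      then show ?thesis by (simp add: X_def right_diff_distrib add.commute)
    qed
    ultimately show "(\<lambda>n. (3/5) ^ n * X (Suc (m + n))) \<longlonglongrightarrow> 0" by simp
  qed auto
  then have X: "X \<longlonglongrightarrow> 0" by (rule LIMSEQ_imp_Suc)
  have "(\<lambda>m. (5/3) * (X m + L) - 2 * (X (Suc m) + L) - flux a b m + (4/3) * L)
      \<longlonglongrightarrow> (5/3) * (0 + L) - 2 * (0 + L) - L + (4/3) * L"
    by (intro tendsto_intros X flux LIMSEQ_Suc)
  then have "(\<lambda>m. (5/3) * (X m + L) - 2 * (X (Suc m) + L) - flux a b m + (4/3) * L) \<longlonglongrightarrow> 0"
    by simp
  moreover have "(5/3) * (X m + L) - 2 * (X (Suc m) + L) - flux a b m + (4/3) * L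
      = (5/3) ^ Suc m * (a (Suc m) - (B + (- (4/3) * L) * (3/5) ^ Suc m))" for m
    unfolding rescaled_expansion by (simp add: X_def flux_def field_simps)
  ultimately have "(\<lambda>m. (5/3) ^ Suc m * (a (Suc m) - (B + (- (4/3) * L) * (3/5) ^ Suc m)))
      \<longlonglongrightarrow> 0" by (simp only:)
  then show ?thesis by (rule LIMSEQ_imp_Suc)
qed

section \<open>The points of the half gasket\<close>

lemma Fw_replicate: "Fw q (replicate m j) x = q j + (1/2) ^ m *\<^sub>R (x - q j)"
proof (induction m)
  case (Suc m)
  have "Fw q (replicate (Suc m) j) x = (1/2) *\<^sub>R (Fw q (replicate m j) x + q j)"
    by (simp add: Fw_def F_def)
  also have "\<dots> = (1/2) *\<^sub>R (q j + q j) + (1/2) *\<^sub>R ((1/2) ^ m *\<^sub>R (x - q j))"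
    unfolding Suc by (simp add: scaleR_right_distrib)
  also have "(1/2) *\<^sub>R (q j + q j) = q j" by simp
  finally show ?case by simp
qed (simp add: Fw_def)

lemma Fw_append: "Fw q (v @ w) x = Fw q v (Fw q w x)"
  by (simp add: Fw_def)

lemma Fw_replicate_tendsto: "(\<lambda>m. Fw q (replicate m j) x) \<longlonglongrightarrow> q j"
proof -
  have "(\<lambda>m. q j + (1/2) ^ m *\<^sub>R (x - q j)) \<longlonglongrightarrow> q j + 0 *\<^sub>R (x - q j)"
    by (intro tendsto_intros LIMSEQ_realpow_zero) auto
  then show ?thesis by (simp add: Fw_replicate)
qed

text \<open>Iterating \<open>F q j\<close> on any point of the gasket converges to its fixed point \<open>q j\<close>.\<close>

lemma vertex_in_gasket:
  assumes "is_gasket q K" and "j < 3"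
  shows "q j \<in> K"
proof -
  from assms obtain x where x: "x \<in> K" by (auto simp: is_gasket_def)
  have step: "F q j z \<in> K" if "z \<in> K" for z
    using assms that unfolding is_gasket_def by blast
  have "Fw q (replicate m j) x \<in> K" for m
    using x step by (induction m) (auto simp: Fw_def)
  moreover have "closed K" using assms by (simp add: is_gasket_def compact_imp_closed)
  ultimately show ?thesis
    by (intro closed_sequentially[OF _ _ Fw_replicate_tendsto[of q j x]])
qed

lemma ypt_in_Omega_bar:
  assumes "is_gasket q K"
  shows "ypt q m \<in> Omega_bar q K"
proof -
  have "ypt q m = Fw q (Yword (Suc m)) (q 1)"
    by (simp add: ypt_def Yword_def Fw_append) (simp add: Fw_def F_def flip: scaleR_2)
  then have "ypt q m \<in> Fw q (Yword (Suc m)) ` K"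
    using vertex_in_gasket[OF assms, of 1] by simp
  then show ?thesis unfolding Omega_bar_def by force
qed

lemma tendsto_along_ypt:
  assumes "is_gasket q K" and "continuous_on (Omega_bar q K) u"
  shows "(\<lambda>m. u (ypt q m)) \<longlonglongrightarrow> u (q 0)"
proof -
  have "(\<lambda>m. ypt q m) \<longlonglongrightarrow> q 0"
    unfolding ypt_def by (rule Fw_replicate_tendsto)
  then show ?thesis
    using assms ypt_in_Omega_bar[OF assms(1)]
    by (intro continuous_on_tendsto_compose[OF assms(2)]) (auto simp: Omega_bar_def)
qed

lemma matching_recurrence_of_laplace_zero:
  assumes "laplace_zero q K u" and x: "\<And>m. m \<ge> 1 \<Longrightarrow> u (xpt q m) = a m"
  shows "matching_recurrence a (\<lambda>m. u (ypt q m))"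
  unfolding matching_recurrence_def
proof
  fix m
  let ?b = "\<lambda>m. u (ypt q m)"
  have "(5/3) ^ (m + 1) * (2 * ?b (m + 1) - ?b m - a (m + 1))
      + (5/3) ^ (m + 2) * (2 * ?b (m + 1) - ?b (m + 2) - a (m + 2)) = 0"
    using assms(1)[unfolded laplace_zero_def, THEN conjunct2, rule_format, of "m + 1"]
      x[of "m + 1"] x[of "m + 2"]
    by (simp add: add.assoc)
  then have "(5/3) ^ (m + 1) * ((2 * ?b (m + 1) - ?b m - a (m + 1))
      + (5/3) * (2 * ?b (m + 1) - ?b (m + 2) - a (m + 2))) = 0"
    by (simp only: distrib_left power_Suc2 add_2_eq_Suc' Suc_eq_plus1[symmetric] mult.assoc)
  then have "(2 * ?b (m + 1) - ?b m - a (m + 1))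
      + (5/3) * (2 * ?b (m + 1) - ?b (m + 2) - a (m + 2)) = 0"
    by (simp only: mult_eq_0_iff) simp
  then show "5 * ?b (m + 2) = 16 * ?b (m + 1) - 3 * ?b m - 3 * a (m + 1) - 5 * a (m + 2)"
    by (simp add: field_simps)
qed

lemma smallo_geometric_iff:
  fixes f :: "nat \<Rightarrow> real"
  shows "f \<in> o(\<lambda>m. (3/5) ^ m) \<longleftrightarrow> (\<lambda>m. (5/3) ^ m * f m) \<longlonglongrightarrow> 0"
proof -
  have "f m / (3/5) ^ m = (5/3) ^ m * f m" for m
    by (simp add: power_divide)
  then show ?thesis
    using smalloI_tendsto[of f "\<lambda>m. (3/5) ^ m" sequentially]
      smalloD_tendsto[of f sequentially "\<lambda>m. (3/5) ^ m"] by auto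
qed

theorem theorem4p4:
  fixes q :: "nat \<Rightarrow> real^2" and SG :: "(real^2) set"
    and a :: "nat \<Rightarrow> real" and u :: "real^2 \<Rightarrow> real"
  assumes "equilateral q"
    and "is_gasket q SG"
    and "convergent a"
    and "continuous_on (Omega_bar q SG) u"
    and "laplace_zero q SG u"
    and "u (q 1) = a 0"
    and "\<And>m. m \<ge> 1 \<Longrightarrow> u (xpt q m) = a m"
  shows "(\<exists>D. has_normal_deriv_q0 q u D) \<longleftrightarrow>
    (\<exists>A1 A2. (\<lambda>m. a m - (A1 + A2 * (3/5)^m)) \<in> o(\<lambda>m. (3/5)^m))"
proof -
  define b where "b m = u (ypt q m)" for m
  have b: "b \<longlonglongrightarrow> u (q 0)"
    unfolding b_def[abs_def] using assms(2,4) by (rule tendsto_along_ypt)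
  have rec: "matching_recurrence a b"
    unfolding b_def[abs_def] using assms(5,7) by (rule matching_recurrence_of_laplace_zero)
  have "(\<lambda>m. normal_deriv_y q u (Suc m)) = flux a b"
    by (rule ext) (simp add: normal_deriv_y_def flux_def b_def assms(7))
  then have "normal_deriv_y q u \<longlonglongrightarrow> L \<longleftrightarrow> flux a b \<longlonglongrightarrow> L" for L
    using filterlim_sequentially_Suc[of "normal_deriv_y q u" "nhds L"] by simp
  then have "(\<exists>D. has_normal_deriv_q0 q u D) \<longleftrightarrow> (\<exists>L. flux a b \<longlonglongrightarrow> L)"
    by (auto simp: has_normal_deriv_q0_def)
  also have "\<dots> \<longleftrightarrow> (\<exists>A1 A2. (\<lambda>m. (5/3) ^ m * (a m - (A1 + A2 * (3/5) ^ m))) \<longlonglongrightarrow> 0)"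
    using flux_converges_if_expansion[OF rec b] expansion_if_flux_converges[OF rec b] by blast
  finally show ?thesis by (simp only: smallo_geometric_iff)
qed

end
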